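(* Let $n\ge 1$. The set $\mathcal U(n)=M(n)^\times\cup\{[0]\}$ is a hyperfield with the operations induced from $M(n)$ if and only if $n$ is prime.
   Context: For a positive integer $n$, $\mathbb Z_n=\mathbb Z/n\mathbb Z$, $\mathbb Z_n^\times$ is its group of units, and $S_n=\{u^2:u\in\mathbb Z_n^\times\}$. $M(n)$ denotes the Marshall quotient of $\mathbb Z_n$ by $S_n$: the underlying set is the quotient of $\mathbb Z_n$ by the equivalence relation $a\sim b\iff as=bt$ for some $s,t\in S_n$; the class of $a$ is written $[a]$. The operations are $[a][b]=[ab]$, $-[a]=[-a]$, and the multivalued addition $[a]+[b]=\{[c]: cr=as+bt\text{ for some }r,s,t\in S_n\}$, with zero $[0]$ and unit $[1]$. $M(n)^\times$ denotes the set of $x\in M(n)$ for which there is $y\in M(n)$ with $xy=[1]$. A (commutative) multiring is $(R,+,\cdot,-,0,1)$ with $+:R\times R\to\mathcal P(R)\setminus\{\emptyset\}$, $\cdot:R\times R\to R$, $-:R\to R$ and $0,1\in R$ such that: $(R,+,-,0)$ is a commutative multigroup, i.e. for all $a,b,c,t$: $c\in a+b$ implies $a\in c+(-b)$ and $b\in(-a)+c$; $b\in a+0$ iff $a=b$; if $x\in a+b$ and $t\in x+c$ for some $x$, then there is $y\in b+c$ with $t\in a+y$; $c\in a+b$ iff $c\in b+a$; moreover $(R,\cdot,1)$ is a commutative monoid, $a\cdot 0=0$ for all $a$, and $c\in a+b$ implies $cd\in ad+bd$. A hyperfield is a multiring with $0\neq 1$ in which every non-zero element is invertible (equivalently, for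 such multirings, one also has $(a+b)d=ad+bd$). "$\mathcal U(n)$ is a hyperfield with the operations induced from $M(n)$" means: $\mathcal U(n)$ contains $[0],[1]$, is closed under product and negation, satisfies $x+y\subseteq\mathcal U(n)$ (sum computed in $M(n)$) for all $x,y\in\mathcal U(n)$, and with the restricted operations is a hyperfield. *)

theory Defs
  imports "HOL-Algebra.IntRing"
begin

section \<open>Multirings and hyperfields\<close>

record 'a multiring = "'a monoid" +
  mzero :: 'a
  mneg :: "'a \<Rightarrow> 'a"
  madd :: "'a \<Rightarrow> 'a \<Rightarrow> 'a set" (infixl \<open>\<boxplus>\<index>\<close> 65)

locale comm_multigroup =
  fixes R (structure)
  assumes mzero_closed: "mzero R \<in> carrier R"
    and mneg_closed: "a \<in> carrier R \<Longrightarrow> mneg R a \<in> carrier R"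
    and madd_closed: "\<lbrakk>a \<in> carrier R; b \<in> carrier R\<rbrakk> \<Longrightarrow> a \<boxplus> b \<subseteq> carrier R"
    and madd_nonempty: "\<lbrakk>a \<in> carrier R; b \<in> carrier R\<rbrakk> \<Longrightarrow> a \<boxplus> b \<noteq> {}"
    and madd_reversible:
      "\<lbrakk>a \<in> carrier R; b \<in> carrier R; c \<in> carrier R; c \<in> a \<boxplus> b\<rbrakk>
        \<Longrightarrow> a \<in> c \<boxplus> mneg R b \<and> b \<in> mneg R a \<boxplus> c"
    and madd_mzero:
      "\<lbrakk>a \<in> carrier R; b \<in> carrier R\<rbrakk> \<Longrightarrow> b \<in> a \<boxplus> mzero R \<longleftrightarrow> a = b"
    and madd_assoc:
      "\<lbrakk>a \<in> carrier R; b \<in> carrier R; c \<in> carrier R; t \<in> carrier R; x \<in> carrier R;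
        x \<in> a \<boxplus> b; t \<in> x \<boxplus> c\<rbrakk> \<Longrightarrow> \<exists>y \<in> carrier R. y \<in> b \<boxplus> c \<and> t \<in> a \<boxplus> y"
    and madd_commute:
      "\<lbrakk>a \<in> carrier R; b \<in> carrier R; c \<in> carrier R\<rbrakk> \<Longrightarrow> c \<in> a \<boxplus> b \<longleftrightarrow> c \<in> b \<boxplus> a"

locale multiring = comm_multigroup R + comm_monoid R for R (structure) +
  assumes mult_mzero: "a \<in> carrier R \<Longrightarrow> a \<otimes> mzero R = mzero R"
    and madd_mult:
      "\<lbrakk>a \<in> carrier R; b \<in> carrier R; c \<in> carrier R; d \<in> carrier R; c \<in> a \<boxplus> b\<rbrakk>
        \<Longrightarrow> c \<otimes> d \<in> (a \<otimes> d) \<boxplus> (b \<otimes> d)"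

locale hyperfield = multiring +
  assumes mzero_neq_one: "mzero R \<noteq> \<one>"
    and nonzero_invertible: "\<lbrakk>a \<in> carrier R; a \<noteq> mzero R\<rbrakk> \<Longrightarrow> a \<in> Units R"

definition induced_hyperfield :: "('a, 'b) multiring_scheme \<Rightarrow> 'a set \<Rightarrow> bool" where
  "induced_hyperfield R U \<longleftrightarrow>
     U \<subseteq> carrier R \<and> mzero R \<in> U \<and> \<one>\<^bsub>R\<^esub> \<in> U \<and>
     (\<forall>x\<in>U. \<forall>y\<in>U. x \<otimes>\<^bsub>R\<^esub> y \<in> U) \<and>
     (\<forall>x\<in>U. mneg R x \<in> U) \<and>
     (\<forall>x\<in>U. \<forall>y\<in>U. x \<boxplus>\<^bsub>R\<^esub> y \<subseteq> U) \<and>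
     hyperfield (R\<lparr>carrier := U\<rparr>)"


section \<open>The Marshall quotient\<close>

definition marshall_rel :: "('a, 'b) ring_scheme \<Rightarrow> 'a set \<Rightarrow> ('a \<times> 'a) set" where
  "marshall_rel A S =
     {(a, b). a \<in> carrier A \<and> b \<in> carrier A \<and> (\<exists>s\<in>S. \<exists>t\<in>S. a \<otimes>\<^bsub>A\<^esub> s = b \<otimes>\<^bsub>A\<^esub> t)}"

definition marshall_class :: "('a, 'b) ring_scheme \<Rightarrow> 'a set \<Rightarrow> 'a \<Rightarrow> 'a set" where
  "marshall_class A S a = marshall_rel A S `` {a}"

text \<open>
  The operations are unions over all representatives of the arguments.
  For a multiplicatively closed set \<open>S\<close> containing \<open>1\<close>, the lemmas below show that
  any choice of representatives gives the same result, i.e. that these are the usual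
  operations \<open>[a][b] = [ab]\<close>, \<open>-[a] = [-a]\<close> and
  \<open>[a] + [b] = {[c]. cr = as + bt for some r, s, t \<in> S}\<close>.
\<close>

definition marshall_quotient :: "('a, 'b) ring_scheme \<Rightarrow> 'a set \<Rightarrow> 'a set multiring" where
  "marshall_quotient A S =
     \<lparr>carrier = carrier A // marshall_rel A S,
      mult = (\<lambda>X Y. \<Union>a\<in>X. \<Union>b\<in>Y. marshall_class A S (a \<otimes>\<^bsub>A\<^esub> b)),
      one = marshall_class A S \<one>\<^bsub>A\<^esub>,
      mzero = marshall_class A S \<zero>\<^bsub>A\<^esub>,
      mneg = (\<lambda>X. \<Union>a\<in>X. marshall_class A S (\<ominus>\<^bsub>A\<^esub> a)),
      madd = (\<lambda>X Y. {marshall_class A S c | a b c r s t.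
        a \<in> X \<and> b \<in> Y \<and> c \<in> carrier A \<and> r \<in> S \<and> s \<in> S \<and> t \<in> S \<and>
        c \<otimes>\<^bsub>A\<^esub> r = (a \<otimes>\<^bsub>A\<^esub> s) \<oplus>\<^bsub>A\<^esub> (b \<otimes>\<^bsub>A\<^esub> t)})\<rparr>"

definition unit_squares :: "('a, 'b) ring_scheme \<Rightarrow> 'a set" where
  "unit_squares A = {u [^]\<^bsub>A\<^esub> (2::nat) | u. u \<in> Units A}"

definition M :: "nat \<Rightarrow> int set set multiring" where
  "M n = marshall_quotient (ZFact (int n)) (unit_squares (ZFact (int n)))"

definition \<U> :: "nat \<Rightarrow> int set set set" where
  "\<U> n = Units (M n) \<union> {mzero (M n)}"


section \<open>Independence of representatives\<close>

locale marshall_setting = cring A for A (structure) +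
  fixes S
  assumes S_carrier: "S \<subseteq> carrier A"
    and S_one: "\<one> \<in> S"
    and S_mult: "\<lbrakk>s \<in> S; t \<in> S\<rbrakk> \<Longrightarrow> s \<otimes> t \<in> S"
begin

lemma S_closed [simp]: "s \<in> S \<Longrightarrow> s \<in> carrier A"
  using S_carrier by blast

lemma equiv_marshall_rel: "equiv (carrier A) (marshall_rel A S)"
proof (rule equivI)
  show "marshall_rel A S \<subseteq> carrier A \<times> carrier A"
    by (auto simp: marshall_rel_def)
  show "refl_on (carrier A) (marshall_rel A S)"
    using S_one by (auto simp: refl_on_def marshall_rel_def)
  show "sym (marshall_rel A S)"
    by (auto simp: sym_def marshall_rel_def) metis
  show "trans (marshall_rel A S)"
  proof (rule transI)
    fix a b c
    assume "(a, b) \<in> marshall_rel A S" "(b, c) \<in> marshall_rel A S"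
    then obtain s t s' t' where *: "a \<in> carrier A" "b \<in> carrier A" "c \<in> carrier A"
      "s \<in> S" "t \<in> S" "s' \<in> S" "t' \<in> S" "a \<otimes> s = b \<otimes> t" "b \<otimes> s' = c \<otimes> t'"
      by (auto simp: marshall_rel_def)
    have "a \<otimes> (s \<otimes> s') = (a \<otimes> s) \<otimes> s'" using *(1-7) by (simp add: m_assoc)
    also have "\<dots> = (b \<otimes> s') \<otimes> t" unfolding *(8) using *(1-7) by (simp add: m_ac)
    also have "\<dots> = c \<otimes> (t' \<otimes> t)" unfolding *(9) using *(1-7) by (simp add: m_assoc)
    finally show "(a, c) \<in> marshall_rel A S"
      using *(1,3) S_mult[OF *(4,6)] S_mult[OF *(7,5)] unfolding marshall_rel_def by blast
  qed
qed

lemma marshall_class_self: "a \<in> carrier A \<Longrightarrow> a \<in> marshall_class A S a"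
  using equiv_class_self[OF equiv_marshall_rel] by (simp add: marshall_class_def)

lemma marshall_class_eq_iff:
  assumes "a \<in> carrier A" "b \<in> carrier A"
  shows "marshall_class A S a = marshall_class A S b \<longleftrightarrow> (\<exists>s\<in>S. \<exists>t\<in>S. a \<otimes> s = b \<otimes> t)"
  using eq_equiv_class_iff[OF equiv_marshall_rel assms] assms
  by (simp add: marshall_class_def) (simp add: marshall_rel_def)

lemma mem_marshall_class:
  assumes "a \<in> carrier A"
  shows "b \<in> marshall_class A S a \<longleftrightarrow> b \<in> carrier A \<and> (\<exists>s\<in>S. \<exists>t\<in>S. a \<otimes> s = b \<otimes> t)"
  using assms by (auto simp: marshall_class_def marshall_rel_def)

lemma marshall_quotient_carrier:
  "carrier (marshall_quotient A S) = marshall_class A S ` carrier A"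
  by (auto simp: marshall_quotient_def quotient_def marshall_class_def)

lemma marshall_quotient_mult:
  assumes ab: "a \<in> carrier A" "b \<in> carrier A"
  shows "marshall_class A S a \<otimes>\<^bsub>marshall_quotient A S\<^esub> marshall_class A S b
    = marshall_class A S (a \<otimes> b)"
proof -
  have "marshall_class A S (a' \<otimes> b') = marshall_class A S (a \<otimes> b)"
    if "a' \<in> marshall_class A S a" "b' \<in> marshall_class A S b" for a' b'
  proof -
    from that ab obtain s t s' t' where *: "a' \<in> carrier A" "b' \<in> carrier A"
      "s \<in> S" "t \<in> S" "s' \<in> S" "t' \<in> S" "a \<otimes> s = a' \<otimes> t" "b \<otimes> s' = b' \<otimes> t'"
      by (auto simp: mem_marshall_class)
    have "(a' \<otimes> b') \<otimes> (t \<otimes> t') = (a' \<otimes> t) \<otimes> (b' \<otimes> t')" using *(1-6) by (simp add: m_ac)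
    also have "\<dots> = (a \<otimes> s) \<otimes> (b \<otimes> s')" by (simp only: *(7,8))
    also have "\<dots> = (a \<otimes> b) \<otimes> (s \<otimes> s')" using *(3-6) ab by (simp add: m_ac)
    finally have "\<exists>x\<in>S. \<exists>y\<in>S. (a' \<otimes> b') \<otimes> x = (a \<otimes> b) \<otimes> y"
      using S_mult[OF *(4,6)] S_mult[OF *(3,5)] by blast
    then show ?thesis
      using *(1,2) ab by (simp add: marshall_class_eq_iff)
  qed
  then have "(\<Union>a'\<in>marshall_class A S a. \<Union>b'\<in>marshall_class A S b. marshall_class A S (a' \<otimes> b'))
    = (\<Union>a'\<in>marshall_class A S a. \<Union>b'\<in>marshall_class A S b. marshall_class A S (a \<otimes> b))"
    by (intro SUP_cong refl)
  also have "\<dots> = marshall_class A S (a \<otimes> b)"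
    using marshall_class_self[OF ab(1)] marshall_class_self[OF ab(2)] by blast
  finally show ?thesis
    by (simp add: marshall_quotient_def)
qed

lemma marshall_quotient_mneg:
  assumes a: "a \<in> carrier A"
  shows "mneg (marshall_quotient A S) (marshall_class A S a) = marshall_class A S (\<ominus> a)"
proof -
  have "marshall_class A S (\<ominus> a') = marshall_class A S (\<ominus> a)"
    if "a' \<in> marshall_class A S a" for a'
  proof -
    from that a obtain s t where *: "a' \<in> carrier A" "s \<in> S" "t \<in> S" "a \<otimes> s = a' \<otimes> t"
      by (auto simp: mem_marshall_class)
    then have "(\<ominus> a') \<otimes> t = (\<ominus> a) \<otimes> s" using a by (simp add: l_minus)
    then have "\<exists>x\<in>S. \<exists>y\<in>S. (\<ominus> a') \<otimes> x = (\<ominus> a) \<otimes> y"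
      using *(2,3) by blast
    then show ?thesis
      using *(1) a by (simp add: marshall_class_eq_iff)
  qed
  then have "(\<Union>a'\<in>marshall_class A S a. marshall_class A S (\<ominus> a'))
    = (\<Union>a'\<in>marshall_class A S a. marshall_class A S (\<ominus> a))"
    by (intro SUP_cong refl)
  also have "\<dots> = marshall_class A S (\<ominus> a)"
    using marshall_class_self[OF a] by blast
  finally show ?thesis
    by (simp add: marshall_quotient_def)
qed

lemma marshall_quotient_madd:
  assumes ab: "a \<in> carrier A" "b \<in> carrier A"
  shows "marshall_class A S a \<boxplus>\<^bsub>marshall_quotient A S\<^esub> marshall_class A S b
    = {marshall_class A S c | c. c \<in> carrier A \<and>
        (\<exists>r\<in>S. \<exists>s\<in>S. \<exists>t\<in>S. c \<otimes> r = (a \<otimes> s) \<oplus> (b \<otimes> t))}"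
    (is "?L = ?R")
proof
  show "?R \<subseteq> ?L"
    using marshall_class_self[OF ab(1)] marshall_class_self[OF ab(2)]
    unfolding marshall_quotient_def by (simp only: multiring.simps) blast
  show "?L \<subseteq> ?R"
  proof
    fix X assume "X \<in> ?L"
    then obtain a' b' c r s t where X: "X = marshall_class A S c"
      and mem: "a' \<in> marshall_class A S a" "b' \<in> marshall_class A S b"
      and c: "c \<in> carrier A" "r \<in> S" "s \<in> S" "t \<in> S" "c \<otimes> r = (a' \<otimes> s) \<oplus> (b' \<otimes> t)"
      unfolding marshall_quotient_def by (simp only: multiring.simps) blast
    from mem ab obtain u v u' v' where *: "a' \<in> carrier A" "b' \<in> carrier A"
      "u \<in> S" "v \<in> S" "u' \<in> S" "v' \<in> S" "a \<otimes> u = a' \<otimes> v" "b \<otimes> u' = b' \<otimes> v'"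
      by (auto simp: mem_marshall_class)
    have "c \<otimes> (r \<otimes> (v \<otimes> v')) = (c \<otimes> r) \<otimes> (v \<otimes> v')" using c(1-4) *(1-6) by (simp add: m_assoc)
    also have "\<dots> = (a' \<otimes> v) \<otimes> (s \<otimes> v') \<oplus> (b' \<otimes> v') \<otimes> (t \<otimes> v)"
      unfolding c(5) using c(1-4) *(1-6) by (simp add: l_distr r_distr m_ac)
    also have "\<dots> = (a \<otimes> u) \<otimes> (s \<otimes> v') \<oplus> (b \<otimes> u') \<otimes> (t \<otimes> v)" by (simp only: *(7,8))
    also have "\<dots> = a \<otimes> (u \<otimes> (s \<otimes> v')) \<oplus> b \<otimes> (u' \<otimes> (t \<otimes> v))"
      using ab c(1-4) *(1-6) by (simp add: m_assoc)
    finally have "c \<otimes> (r \<otimes> (v \<otimes> v')) = a \<otimes> (u \<otimes> (s \<otimes> v')) \<oplus> b \<otimes> (u' \<otimes> (t \<otimes> v))" .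
    moreover have "r \<otimes> (v \<otimes> v') \<in> S" "u \<otimes> (s \<otimes> v') \<in> S" "u' \<otimes> (t \<otimes> v) \<in> S"
      using c(2-4) *(3-6) by (simp_all add: S_mult)
    ultimately show "X \<in> ?R" using X c(1) by blast
  qed
qed

end

lemma (in cring) marshall_setting_unit_squares: "marshall_setting R (unit_squares R)"
proof unfold_locales
  show "unit_squares R \<subseteq> carrier R"
    by (auto simp: unit_squares_def)
  show "\<one> \<in> unit_squares R"
    unfolding unit_squares_def by (auto intro!: exI[of _ "\<one>"])
  fix s t assume "s \<in> unit_squares R" "t \<in> unit_squares R"
  then obtain u v where *: "s = u [^] (2::nat)" "t = v [^] (2::nat)" "u \<in> Units R" "v \<in> Units R"
    by (auto simp: unit_squares_def)
  then have "s \<otimes> t = (u \<otimes> v) [^] (2::nat)"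
    by (simp add: Units_closed nat_pow_distrib)
  moreover have "u \<otimes> v \<in> Units R" using * by simp
  ultimately show "s \<otimes> t \<in> unit_squares R"
    unfolding unit_squares_def by blast
qed

end

theory Submission
  imports Defs "HOL-Number_Theory.Cong"
begin

text \<open>
  The Marshall quotient of any commutative ring \<open>A\<close> by a multiplicative set \<open>S\<close> is a
  multiring: each axiom follows from a ring identity after clearing the multipliers from \<open>S\<close>
  (\<open>multiring_marshall_quotient\<close>). If \<open>S\<close> consists of units, then \<open>[a]\<close> is invertible only
  for invertible \<open>a\<close>, and \<open>[a] = [0]\<close> only for \<open>a = 0\<close>, so statements about invertible and
  zero classes translate directly into statements about \<open>A\<close>.

  For prime \<open>n\<close> the ring \<open>\<int>/n\<close> is a field. Every nonzero class is then invertible, hence the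
  units with zero are the whole quotient, which is a hyperfield.

  Conversely, the class of \<open>a + b\<close> is always a member of \<open>[a] + [b]\<close>. So if the units with
  zero are closed under multivalued addition, the sum of two units of \<open>\<int>/n\<close> is a unit or zero.
  Starting from \<open>1\<close> and adding \<open>1\<close> repeatedly, no sum vanishes before \<open>n\<close> is reached, so
  \<open>1, \<dots>, n - 1\<close> are all units and \<open>n\<close> has no proper divisor
  (\<open>prime_if_Units_sum\<close>). The case \<open>n = 1\<close> is excluded by \<open>0 \<noteq> 1\<close> in a hyperfield.
\<close>

section \<open>The Marshall quotient is a multiring\<close>

context marshall_setting
begin

abbreviation cls :: "'a \<Rightarrow> 'a set" where
  "cls \<equiv> marshall_class A S"

abbreviation Q :: "'a set multiring" where
  "Q \<equiv> marshall_quotient A S"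

lemma mzero_marshall_quotient: "mzero Q = cls \<zero>"
  by (simp add: marshall_quotient_def)

lemma one_marshall_quotient: "\<one>\<^bsub>Q\<^esub> = cls \<one>"
  by (simp add: marshall_quotient_def)

lemma marshall_quotient_elem:
  assumes "X \<in> carrier Q"
  obtains a where "a \<in> carrier A" "X = cls a"
  using assms by (auto simp: marshall_quotient_carrier)

lemma cls_closed: "a \<in> carrier A \<Longrightarrow> cls a \<in> carrier Q"
  by (simp add: marshall_quotient_carrier)

text \<open>
  The sum is given as a set of classes, so a priori \<open>[c]\<close> belongs to it because of some other
  representative \<open>c'\<close>. As \<open>c u = c' v\<close> with \<open>u\<close>, \<open>v\<close> in \<open>S\<close>, the change of representative
  is absorbed by the multipliers, and \<open>c\<close> itself satisfies an equation of the required shape.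
\<close>

lemma cls_mem_madd_iff:
  assumes "a \<in> carrier A" "b \<in> carrier A" "c \<in> carrier A"
  shows "cls c \<in> cls a \<boxplus>\<^bsub>Q\<^esub> cls b \<longleftrightarrow>
    (\<exists>r\<in>S. \<exists>s\<in>S. \<exists>t\<in>S. c \<otimes> r = a \<otimes> s \<oplus> b \<otimes> t)"
proof
  assume "cls c \<in> cls a \<boxplus>\<^bsub>Q\<^esub> cls b"
  then obtain c' r s t where c': "cls c = cls c'" "c' \<in> carrier A"
    and rst: "r \<in> S" "s \<in> S" "t \<in> S" "c' \<otimes> r = a \<otimes> s \<oplus> b \<otimes> t"
    using assms by (auto simp: marshall_quotient_madd)
  from c' assms(3) obtain u v where uv: "u \<in> S" "v \<in> S" "c \<otimes> u = c' \<otimes> v"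
    by (auto simp: marshall_class_eq_iff)
  have "c \<otimes> (u \<otimes> r) = (c \<otimes> u) \<otimes> r"
    using assms uv(1,2) rst(1-3) by (simp add: m_assoc)
  also have "\<dots> = (c' \<otimes> r) \<otimes> v"
    unfolding uv(3) using c'(2) uv(1,2) rst(1-3) by (simp add: m_ac)
  also have "\<dots> = a \<otimes> (s \<otimes> v) \<oplus> b \<otimes> (t \<otimes> v)"
    unfolding rst(4) using assms uv(1,2) rst(1-3) by (simp add: l_distr m_assoc)
  finally show "\<exists>r\<in>S. \<exists>s\<in>S. \<exists>t\<in>S. c \<otimes> r = a \<otimes> s \<oplus> b \<otimes> t"
    using S_mult uv(1,2) rst(1-3) by blast
next
  assume "\<exists>r\<in>S. \<exists>s\<in>S. \<exists>t\<in>S. c \<otimes> r = a \<otimes> s \<oplus> b \<otimes> t"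
  then show "cls c \<in> cls a \<boxplus>\<^bsub>Q\<^esub> cls b"
    using assms by (auto simp: marshall_quotient_madd)
qed

lemma cls_add_mem_madd:
  assumes "a \<in> carrier A" "b \<in> carrier A"
  shows "cls (a \<oplus> b) \<in> cls a \<boxplus>\<^bsub>Q\<^esub> cls b"
  using assms S_one
  by (subst cls_mem_madd_iff) (auto intro!: bexI[of _ \<one>])

lemma marshall_quotient_madd_reversible:
  assumes "a \<in> carrier A" "b \<in> carrier A" "c \<in> carrier A" "cls c \<in> cls a \<boxplus>\<^bsub>Q\<^esub> cls b"
  shows "cls a \<in> cls c \<boxplus>\<^bsub>Q\<^esub> mneg Q (cls b)" "cls b \<in> mneg Q (cls a) \<boxplus>\<^bsub>Q\<^esub> cls c"
proof -
  from assms obtain r s t where rst: "r \<in> S" "s \<in> S" "t \<in> S" "c \<otimes> r = a \<otimes> s \<oplus> b \<otimes> t"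
    by (auto simp: cls_mem_madd_iff)
  have "a \<otimes> s = c \<otimes> r \<oplus> \<ominus> b \<otimes> t"
    unfolding rst(4) using assms(1-3) rst(1-3) by (simp add: l_minus a_assoc r_neg)
  then show "cls a \<in> cls c \<boxplus>\<^bsub>Q\<^esub> mneg Q (cls b)"
    using assms(1-3) rst(1-3) by (auto simp: marshall_quotient_mneg cls_mem_madd_iff)
  have "b \<otimes> t = \<ominus> a \<otimes> s \<oplus> c \<otimes> r"
    unfolding rst(4) using assms(1-3) rst(1-3) by (simp add: l_minus r_neg1)
  then show "cls b \<in> mneg Q (cls a) \<boxplus>\<^bsub>Q\<^esub> cls c"
    using assms(1-3) rst(1-3) by (auto simp: marshall_quotient_mneg cls_mem_madd_iff)
qed

text \<open>
  If \<open>x r = a s + b u\<close> and \<open>t r' = x s' + c u'\<close>, then scaling the second equation by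
  \<open>r\<close> eliminates \<open>x\<close> and leaves \<open>t r' r = a s s' + (b u s' + c u' r)\<close>. The bracket
  represents the required element of \<open>[b] + [c]\<close>.
\<close>

lemma marshall_quotient_madd_assoc:
  assumes carr: "a \<in> carrier A" "b \<in> carrier A" "c \<in> carrier A" "t \<in> carrier A" "x \<in> carrier A"
    and x: "cls x \<in> cls a \<boxplus>\<^bsub>Q\<^esub> cls b" and t: "cls t \<in> cls x \<boxplus>\<^bsub>Q\<^esub> cls c"
  shows "\<exists>y\<in>carrier A. cls y \<in> cls b \<boxplus>\<^bsub>Q\<^esub> cls c \<and> cls t \<in> cls a \<boxplus>\<^bsub>Q\<^esub> cls y"
proof -
  from x carr obtain r s u where rsu: "r \<in> S" "s \<in> S" "u \<in> S" "x \<otimes> r = a \<otimes> s \<oplus> b \<otimes> u"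
    by (auto simp: cls_mem_madd_iff)
  from t carr obtain r' s' u' where rsu': "r' \<in> S" "s' \<in> S" "u' \<in> S" "t \<otimes> r' = x \<otimes> s' \<oplus> c \<otimes> u'"
    by (auto simp: cls_mem_madd_iff)
  note S = rsu(1-3) rsu'(1-3)
  define y where "y = b \<otimes> (u \<otimes> s') \<oplus> c \<otimes> (u' \<otimes> r)"
  have y: "y \<in> carrier A" using carr S by (simp add: y_def)
  have "t \<otimes> (r' \<otimes> r) = (t \<otimes> r') \<otimes> r" using carr S by (simp add: m_assoc)
  also have "\<dots> = (x \<otimes> r) \<otimes> s' \<oplus> c \<otimes> (u' \<otimes> r)"
    unfolding rsu'(4) using carr S by (simp add: l_distr r_distr m_ac)
  also have "\<dots> = a \<otimes> (s \<otimes> s') \<oplus> y \<otimes> \<one>"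
    unfolding rsu(4) y_def using carr S by (simp add: l_distr m_assoc a_assoc)
  finally have "cls t \<in> cls a \<boxplus>\<^bsub>Q\<^esub> cls y"
    using S S_one S_mult unfolding cls_mem_madd_iff[OF carr(1) y carr(4)] by blast
  moreover have "y \<otimes> \<one> = b \<otimes> (u \<otimes> s') \<oplus> c \<otimes> (u' \<otimes> r)"
    using y by (simp add: y_def)
  then have "cls y \<in> cls b \<boxplus>\<^bsub>Q\<^esub> cls c"
    using S S_one S_mult unfolding cls_mem_madd_iff[OF carr(2,3) y] by blast
  ultimately show ?thesis using y by blast
qed

lemma comm_multigroup_marshall_quotient: "comm_multigroup Q"
proof
  show "mzero Q \<in> carrier Q"
    by (simp add: mzero_marshall_quotient cls_closed)
next
  fix X assume "X \<in> carrier Q"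
  then show "mneg Q X \<in> carrier Q"
    by (elim marshall_quotient_elem) (simp add: marshall_quotient_mneg cls_closed)
next
  fix X Y assume X: "X \<in> carrier Q" and Y: "Y \<in> carrier Q"
  from X obtain a where a: "a \<in> carrier A" "X = cls a" by (rule marshall_quotient_elem)
  from Y obtain b where b: "b \<in> carrier A" "Y = cls b" by (rule marshall_quotient_elem)
  show "X \<boxplus>\<^bsub>Q\<^esub> Y \<subseteq> carrier Q"
    using a b by (auto simp: marshall_quotient_madd cls_closed)
  show "X \<boxplus>\<^bsub>Q\<^esub> Y \<noteq> {}"
    using cls_add_mem_madd a b by blast
  show "Y \<in> X \<boxplus>\<^bsub>Q\<^esub> mzero Q \<longleftrightarrow> X = Y"
  proof -
    have "Y \<in> X \<boxplus>\<^bsub>Q\<^esub> mzero Q \<longleftrightarrow> (\<exists>r\<in>S. \<exists>s\<in>S. b \<otimes> r = a \<otimes> s)"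
      using a b S_one by (auto simp: mzero_marshall_quotient cls_mem_madd_iff)
    also have "\<dots> \<longleftrightarrow> X = Y"
      unfolding a(2) b(2) marshall_class_eq_iff[OF a(1) b(1)] by metis
    finally show ?thesis .
  qed
  fix Z assume Z: "Z \<in> carrier Q"
  then obtain c where c: "c \<in> carrier A" "Z = cls c" by (rule marshall_quotient_elem)
  show "X \<in> Z \<boxplus>\<^bsub>Q\<^esub> mneg Q Y \<and> Y \<in> mneg Q X \<boxplus>\<^bsub>Q\<^esub> Z" if "Z \<in> X \<boxplus>\<^bsub>Q\<^esub> Y"
    using marshall_quotient_madd_reversible a b c that by blast
  have "cls z \<in> cls x \<boxplus>\<^bsub>Q\<^esub> cls y \<Longrightarrow> cls z \<in> cls y \<boxplus>\<^bsub>Q\<^esub> cls x"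
    if "x \<in> carrier A" "y \<in> carrier A" "z \<in> carrier A" for x y z
    using that by (auto simp: cls_mem_madd_iff) (metis S_closed a_comm m_closed)
  then show "Z \<in> X \<boxplus>\<^bsub>Q\<^esub> Y \<longleftrightarrow> Z \<in> Y \<boxplus>\<^bsub>Q\<^esub> X"
    using a b c by blast
  fix T V assume T: "T \<in> carrier Q" and V: "V \<in> carrier Q"
    and sums: "V \<in> X \<boxplus>\<^bsub>Q\<^esub> Y" "T \<in> V \<boxplus>\<^bsub>Q\<^esub> Z"
  from T obtain t where t: "t \<in> carrier A" "T = cls t" by (rule marshall_quotient_elem)
  from V obtain v where v: "v \<in> carrier A" "V = cls v" by (rule marshall_quotient_elem)
  show "\<exists>W\<in>carrier Q. W \<in> Y \<boxplus>\<^bsub>Q\<^esub> Z \<and> T \<in> X \<boxplus>\<^bsub>Q\<^esub> W"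
    using marshall_quotient_madd_assoc[of a b c t v] a b c t v sums cls_closed by blast
qed

lemma comm_monoid_marshall_quotient: "Group.comm_monoid Q"
proof (rule comm_monoidI)
  fix X Y Z assume X: "X \<in> carrier Q" and Y: "Y \<in> carrier Q" and Z: "Z \<in> carrier Q"
  from X obtain a where a: "a \<in> carrier A" "X = cls a" by (rule marshall_quotient_elem)
  from Y obtain b where b: "b \<in> carrier A" "Y = cls b" by (rule marshall_quotient_elem)
  from Z obtain c where c: "c \<in> carrier A" "Z = cls c" by (rule marshall_quotient_elem)
  show "X \<otimes>\<^bsub>Q\<^esub> Y \<otimes>\<^bsub>Q\<^esub> Z = X \<otimes>\<^bsub>Q\<^esub> (Y \<otimes>\<^bsub>Q\<^esub> Z)"
    using a b c by (simp add: marshall_quotient_mult m_assoc)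
qed (auto elim!: marshall_quotient_elem
  simp: one_marshall_quotient marshall_quotient_mult cls_closed m_comm)

theorem multiring_marshall_quotient: "multiring Q"
proof -
  interpret Q: comm_multigroup Q by (rule comm_multigroup_marshall_quotient)
  interpret Q: comm_monoid Q by (rule comm_monoid_marshall_quotient)
  show ?thesis
  proof
    fix X assume "X \<in> carrier Q"
    then show "X \<otimes>\<^bsub>Q\<^esub> mzero Q = mzero Q"
      by (auto elim!: marshall_quotient_elem simp: mzero_marshall_quotient marshall_quotient_mult)
  next
    fix X Y Z D assume X: "X \<in> carrier Q" and Y: "Y \<in> carrier Q" and Z: "Z \<in> carrier Q"
      and D: "D \<in> carrier Q" and sum: "Z \<in> X \<boxplus>\<^bsub>Q\<^esub> Y"
    from X obtain a where a: "a \<in> carrier A" "X = cls a" by (rule marshall_quotient_elem)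
    from Y obtain b where b: "b \<in> carrier A" "Y = cls b" by (rule marshall_quotient_elem)
    from Z obtain c where c: "c \<in> carrier A" "Z = cls c" by (rule marshall_quotient_elem)
    from D obtain d where d: "d \<in> carrier A" "D = cls d" by (rule marshall_quotient_elem)
    from sum a b c obtain r s t
      where rst: "r \<in> S" "s \<in> S" "t \<in> S" "c \<otimes> r = a \<otimes> s \<oplus> b \<otimes> t"
      by (auto simp: cls_mem_madd_iff)
    have "c \<otimes> d \<otimes> r = (c \<otimes> r) \<otimes> d" using c d rst(1) by (simp add: m_ac)
    also have "\<dots> = a \<otimes> d \<otimes> s \<oplus> b \<otimes> d \<otimes> t"
      unfolding rst(4) using a b d rst(1-3) by (simp add: l_distr r_distr m_ac)
    finally show "Z \<otimes>\<^bsub>Q\<^esub> D \<in> (X \<otimes>\<^bsub>Q\<^esub> D) \<boxplus>\<^bsub>Q\<^esub> (Y \<otimes>\<^bsub>Q\<^esub> D)"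
      using a b c d rst(1-3) by (auto simp: marshall_quotient_mult cls_mem_madd_iff)
  qed
qed


section \<open>Units of the Marshall quotient\<close>

lemma cls_Units:
  assumes "a \<in> Units A"
  shows "cls a \<in> Units Q"
proof -
  have "cls (inv a) \<otimes>\<^bsub>Q\<^esub> cls a = \<one>\<^bsub>Q\<^esub>" "cls a \<otimes>\<^bsub>Q\<^esub> cls (inv a) = \<one>\<^bsub>Q\<^esub>"
    using assms by (simp_all add: marshall_quotient_mult one_marshall_quotient Units_closed)
  then show ?thesis
    using cls_closed[OF Units_closed[OF assms]] cls_closed[OF Units_inv_closed[OF assms]]
    by (auto simp: Units_def[of Q])
qed

text \<open>
  If \<open>[a][b] = [1]\<close>, then \<open>a b s\<close> lies in \<open>S\<close> for some \<open>s\<close>. Hence invertibility descends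
  to \<open>A\<close> as soon as \<open>S\<close> consists of units.
\<close>

lemma cls_Units_iff:
  assumes S: "S \<subseteq> Units A" and a: "a \<in> carrier A"
  shows "cls a \<in> Units Q \<longleftrightarrow> a \<in> Units A"
proof
  assume "cls a \<in> Units Q"
  then obtain b where b: "b \<in> carrier A" "cls (a \<otimes> b) = cls \<one>"
    using a by (auto simp: Units_def one_marshall_quotient marshall_quotient_mult
      elim!: marshall_quotient_elem)
  then obtain s t where st: "s \<in> S" "t \<in> S" "a \<otimes> b \<otimes> s = \<one> \<otimes> t"
    using a by (auto simp: marshall_class_eq_iff)
  define c where "c = b \<otimes> s \<otimes> inv t"
  have t: "t \<in> Units A" using S st(2) by blast
  have c: "c \<in> carrier A" using b(1) st(1) t by (simp add: c_def)
  have "a \<otimes> c = (a \<otimes> b \<otimes> s) \<otimes> inv t"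
    using a b(1) st(1) t by (simp add: c_def m_assoc)
  also have "\<dots> = \<one>"
    unfolding st(3) using st(2) t by simp
  finally have ac: "a \<otimes> c = \<one>" .
  then have "c \<otimes> a = \<one>"
    using m_comm[OF a c] by simp
  with ac show "a \<in> Units A"
    using a c unfolding Units_def by blast
qed (rule cls_Units)

lemma cls_eq_zero_iff:
  assumes S: "S \<subseteq> Units A" and a: "a \<in> carrier A"
  shows "cls a = cls \<zero> \<longleftrightarrow> a = \<zero>"
proof
  assume "cls a = cls \<zero>"
  then obtain s where s: "s \<in> S" "a \<otimes> s = \<zero>"
    using a by (auto simp: marshall_class_eq_iff)
  have unit: "s \<in> Units A" using S s(1) by blast
  have "a = a \<otimes> s \<otimes> inv s"
    using a s(1) unit by (simp add: m_assoc)
  then show "a = \<zero>"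
    using s(2) unit by simp
qed simp

text \<open>
  The representative \<open>a + b\<close> occurs in \<open>[a] + [b]\<close> (take all three multipliers to be
  \<open>1\<close>), so closure of the units with zero under multivalued addition already forces closure
  under addition in \<open>A\<close>.
\<close>

lemma Units_sum_if_induced_hyperfield:
  assumes S: "S \<subseteq> Units A"
    and hyp: "induced_hyperfield Q (Units Q \<union> {mzero Q})"
    and a: "a \<in> Units A" and b: "b \<in> Units A"
  shows "a \<oplus> b \<in> Units A \<or> a \<oplus> b = \<zero>"
proof -
  note carr = Units_closed[OF a] Units_closed[OF b]
  have "cls a \<boxplus>\<^bsub>Q\<^esub> cls b \<subseteq> Units Q \<union> {mzero Q}"
    using hyp cls_Units[OF a] cls_Units[OF b] unfolding induced_hyperfield_def by blast
  then have "cls (a \<oplus> b) \<in> Units Q \<union> {mzero Q}"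
    using cls_add_mem_madd[OF carr] by blast
  then show ?thesis
    using cls_Units_iff[OF S a_closed[OF carr]] cls_eq_zero_iff[OF S a_closed[OF carr]]
    by (auto simp: mzero_marshall_quotient)
qed

lemma one_neq_zero_if_induced_hyperfield:
  assumes hyp: "induced_hyperfield Q U"
  shows "\<one> \<noteq> \<zero>"
proof -
  have "mzero Q \<noteq> \<one>\<^bsub>Q\<^esub>"
    using hyp hyperfield.mzero_neq_one[of "Q\<lparr>carrier := U\<rparr>"]
    by (simp add: induced_hyperfield_def)
  then show ?thesis
    by (auto simp: mzero_marshall_quotient one_marshall_quotient)
qed

text \<open>
  Over a field every nonzero class is invertible, so the units with zero exhaust the quotient.
  Closure and the multiring axioms are then those of the whole quotient.
\<close>

lemma induced_hyperfield_if_field: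
  assumes A: "field A" and S: "S \<subseteq> Units A"
  shows "induced_hyperfield Q (Units Q \<union> {mzero Q})"
proof -
  interpret A: field A by (rule A)
  interpret Q: multiring Q by (rule multiring_marshall_quotient)
  have unit: "X \<in> Units Q" if "X \<in> carrier Q" "X \<noteq> mzero Q" for X
    using that by (auto elim!: marshall_quotient_elem
      simp: mzero_marshall_quotient A.field_Units intro!: cls_Units)
  have U: "Units Q \<union> {mzero Q} = carrier Q"
    using unit Q.mzero_closed by (auto simp: Units_def)
  have "mzero Q \<noteq> \<one>\<^bsub>Q\<^esub>"
    using cls_eq_zero_iff[OF S, of \<one>] A.one_not_zero
    by (auto simp: mzero_marshall_quotient one_marshall_quotient)
  then have "hyperfield Q"
    using unit by unfold_locales auto
  moreover have "Q\<lparr>carrier := carrier Q\<rparr> = Q"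
    by simp
  ultimately show ?thesis
    unfolding induced_hyperfield_def U
    by (simp add: Q.mzero_closed Q.mneg_closed Q.madd_closed)
qed

end

lemma (in cring) unit_squares_subset_Units: "unit_squares R \<subseteq> Units R"
  by (auto simp: unit_squares_def numeral_2_eq_2)


section \<open>Units and zero in the ring of residues\<close>

abbreviation residue_class :: "nat \<Rightarrow> int \<Rightarrow> int set" where
  "residue_class n k \<equiv> Idl\<^bsub>\<Z>\<^esub> {int n} +>\<^bsub>\<Z>\<^esub> k"

lemma residue_class_hom: "residue_class n \<in> ring_hom \<Z> (ZFact (int n))"
  unfolding ZFact_def by (intro ideal.rcos_ring_hom int.genideal_ideal) simp

lemma carrier_ZFact: "carrier (ZFact (int n)) = range (residue_class n)"
  by (auto simp: ZFact_defs A_RCOSETS_defs a_r_coset_def)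

lemma residue_class_ops:
  "residue_class n k \<in> carrier (ZFact (int n))"
  "residue_class n 1 = \<one>\<^bsub>ZFact (int n)\<^esub>"
  "residue_class n k \<otimes>\<^bsub>ZFact (int n)\<^esub> residue_class n l = residue_class n (k * l)"
  "residue_class n k \<oplus>\<^bsub>ZFact (int n)\<^esub> residue_class n l = residue_class n (k + l)"
  using ring_hom_memE[OF residue_class_hom[of n]] by simp_all

lemma residue_class_eq_iff: "residue_class n k = residue_class n l \<longleftrightarrow> int n dvd k - l"
  using int.quotient_eq_iff_same_a_r_cos[OF int.genideal_ideal[of "{int n}"], of k l]
  by (simp add: int_Idl dvd_def mult.commute)

lemma residue_class_zero: "residue_class n 0 = \<zero>\<^bsub>ZFact (int n)\<^esub>"
  using ring_hom_zero[OF residue_class_hom[of n] cring.axioms(1)[OF int_is_cring]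
      cring.axioms(1)[OF ZFact_is_cring]] by simp

lemma residue_class_eq_zero_iff: "residue_class n k = \<zero>\<^bsub>ZFact (int n)\<^esub> \<longleftrightarrow> int n dvd k"
  using residue_class_eq_iff[of n k 0] by (simp add: residue_class_zero)

lemma residue_class_Units_iff:
  "residue_class n k \<in> Units (ZFact (int n)) \<longleftrightarrow> coprime k (int n)"
proof -
  have "residue_class n k \<in> Units (ZFact (int n)) \<longleftrightarrow> (\<exists>l. int n dvd k * l - 1)"
    unfolding Units_def carrier_ZFact
    by (auto simp: residue_class_ops(3) residue_class_ops(2)[symmetric]
      residue_class_eq_iff mult.commute)
  also have "\<dots> \<longleftrightarrow> coprime k (int n)"
    by (simp add: coprime_iff_invertible_int cong_iff_dvd_diff)
  finally show ?thesis .
qed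

lemma field_ZFact_if_prime:
  assumes "Factorial_Ring.prime n"
  shows "field (ZFact (int n))"
proof (rule cring.cring_fieldI[OF ZFact_is_cring])
  have coprime: "coprime k (int n) \<longleftrightarrow> \<not> int n dvd k" for k
  proof
    assume "coprime k (int n)"
    then show "\<not> int n dvd k"
      using prime_gt_1_nat[OF assms] by (auto simp: coprime_absorb_right)
  next
    assume "\<not> int n dvd k"
    then show "coprime k (int n)"
      using assms prime_imp_coprime[of "int n" k] by (simp add: coprime_commute)
  qed
  have "X \<in> Units (ZFact (int n)) \<longleftrightarrow> X \<noteq> \<zero>\<^bsub>ZFact (int n)\<^esub>" if "X \<in> carrier (ZFact (int n))" for X
  proof -
    from that obtain k where "X = residue_class n k"
      by (auto simp: carrier_ZFact)
    then show ?thesis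
      by (simp only: residue_class_Units_iff residue_class_eq_zero_iff coprime)
  qed
  moreover have "Units (ZFact (int n)) \<subseteq> carrier (ZFact (int n))"
    by (auto simp: Units_def)
  ultimately show "Units (ZFact (int n)) = carrier (ZFact (int n)) - {\<zero>\<^bsub>ZFact (int n)\<^esub>}"
    by blast
qed

text \<open>
  Induction shows that all of \<open>1, \<dots>, n - 1\<close> are coprime to \<open>n\<close>: if \<open>k\<close> is a unit modulo
  \<open>n\<close> and \<open>k + 1 < n\<close>, then \<open>k + 1\<close> is a sum of two units and is not zero modulo \<open>n\<close>.
  A proper divisor of \<open>n\<close> coprime to \<open>n\<close> is \<open>1\<close>.
\<close>

lemma prime_if_Units_sum:
  assumes "n > 1"
    and sum: "\<And>a b. \<lbrakk>a \<in> Units (ZFact (int n)); b \<in> Units (ZFact (int n))\<rbrakk> \<Longrightarrow>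
      a \<oplus>\<^bsub>ZFact (int n)\<^esub> b \<in> Units (ZFact (int n)) \<or> a \<oplus>\<^bsub>ZFact (int n)\<^esub> b = \<zero>\<^bsub>ZFact (int n)\<^esub>"
  shows "Factorial_Ring.prime n"
proof -
  have unit: "coprime (int k) (int n)" if "1 \<le> k" "k < n" for k
    using that
  proof (induction k rule: dec_induct)
    case base
    show ?case by simp
  next
    case (step k)
    then have "\<not> int n dvd int k + 1"
      by (auto dest: zdvd_imp_le)
    then show ?case
      using step sum[of "residue_class n (int k)" "residue_class n 1"]
      by (simp add: residue_class_Units_iff residue_class_ops(4) residue_class_eq_zero_iff
        add.commute)
  qed
  have "d = 1 \<or> d = n" if "d dvd n" for d
  proof (rule disjCI)
    assume "d \<noteq> n"
    then have "coprime d n"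
      using unit[of d] dvd_imp_le[OF that] dvd_pos_nat[OF _ that] \<open>n > 1\<close> by simp
    then show "d = 1"
      using that by (simp add: coprime_absorb_left)
  qed
  then show ?thesis
    using \<open>n > 1\<close> by (simp add: prime_nat_iff)
qed


section \<open>Hyperfields among the units with zero\<close>

theorem corollary5p13:
  fixes n :: nat
  assumes "n \<ge> 1"
  shows "induced_hyperfield (M n) (\<U> n) \<longleftrightarrow> Factorial_Ring.prime n"
proof -
  interpret Zn: cring "ZFact (int n)" by (rule ZFact_is_cring)
  interpret marshall_setting "ZFact (int n)" "unit_squares (ZFact (int n))"
    by (rule Zn.marshall_setting_unit_squares)
  note S = Zn.unit_squares_subset_Units
  show ?thesis
    unfolding M_def \<U>_def
  proof
    assume hyp: "induced_hyperfield Q (Units Q \<union> {mzero Q})"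
    have "\<not> int n dvd 1"
      using one_neq_zero_if_induced_hyperfield[OF hyp] residue_class_eq_zero_iff[of n 1]
      by (simp add: residue_class_ops(2))
    with assms have "n > 1" by (cases "n = 1") auto
    then show "Factorial_Ring.prime n"
      using Units_sum_if_induced_hyperfield[OF S hyp] by (rule prime_if_Units_sum)
  next
    assume "Factorial_Ring.prime n"
    then show "induced_hyperfield Q (Units Q \<union> {mzero Q})"
      using induced_hyperfield_if_field[OF field_ZFact_if_prime S] by blast
  qed
qed

end
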